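(* Let $n$ be a positive integer and let $S\subseteq [n]^3$ be a slice-increasing set. Then $m(|S|,2)\le 3n$. In particular, if there exists $\alpha>1/2$ such that $m(N,2)\ge N^{\alpha}$ for all $N$, then $|S|\le n^{1/\alpha}$.
   Context: $[n]=\{1,\dots,n\}$. A set $S\subseteq\mathbb{R}^3$ is *slice-increasing* if for every two distinct elements $(x,y,z),(x',y',z')$ of $S$, the difference $(x'-x,y'-y,z'-z)$ has at least two nonzero coordinates of the same sign. A set $T\subseteq\mathbb{R}^3$ *avoids* a sign type such as $(+,+,-)$ if there are no two points $\mathbf{p},\mathbf{q}\in T$ such that the coordinates of $\mathbf{q}-\mathbf{p}$ have exactly these signs, where $+$ means strictly positive and $-$ strictly negative. $m(N,2)$ denotes the largest number $M$ such that every set $S\subseteq\mathbb{R}^3$ of size $N$ has a subset $T$ of size $M$ that avoids at least one of the four strict difference types $(+,+,+),(+,+,-),(+,-,+),(-,+,+)$. *)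

theory Defs
  imports "HOL-Analysis.Analysis"
begin

text \<open>The set $[n]^3$, as a subset of $R^3$.\<close>

definition grid3 :: "nat \<Rightarrow> (real ^ 3) set" where
  "grid3 n = {p. \<forall>i. p $ i \<in> real ` {1..n}}"

definition slice_increasing :: "(real ^ 3) set \<Rightarrow> bool" where
  "slice_increasing S \<longleftrightarrow>
     (\<forall>p\<in>S. \<forall>q\<in>S. p \<noteq> q \<longrightarrow>
        (\<exists>i j. i \<noteq> j \<and> (q - p) $ i \<noteq> 0 \<and> (q - p) $ j \<noteq> 0 \<and>
               sgn ((q - p) $ i) = sgn ((q - p) $ j)))"

text \<open>A sign type is encoded as a vector with entries $1$ (for $+$) and $-1$ (for $-$).\<close>

definition avoids :: "(real ^ 3) set \<Rightarrow> real ^ 3 \<Rightarrow> bool" where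
  "avoids T s \<longleftrightarrow> \<not> (\<exists>p\<in>T. \<exists>q\<in>T. \<forall>i. sgn ((q - p) $ i) = s $ i)"

definition strict_types :: "(real ^ 3) set" where
  "strict_types =
     {vector [1, 1, 1], vector [1, 1, -1], vector [1, -1, 1], vector [-1, 1, 1]}"

text \<open>The quantity $m(N,2)$. The admissible $M$ include $0$ (take $T$ empty) and are bounded by
  $N$, so the greatest one exists; finiteness of $S$ matters only for $N = 0$, since the
  cardinality of an infinite set is $0$ by convention.\<close>

definition m2 :: "nat \<Rightarrow> nat" where
  "m2 N = (GREATEST M. \<forall>S :: (real ^ 3) set. finite S \<and> card S = N \<longrightarrow>
             (\<exists>T \<subseteq> S. card T = M \<and> (\<exists>s\<in>strict_types. avoids T s)))"

end

theory Submission
  imports Defs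
begin

text \<open>The bound on \<open>m2\<close> needs a single witness of size \<open>card S\<close>. The set \<open>S\<close> itself need not
  do, because two points that share a coordinate realise no strict type: for a square \<open>n = k * k\<close>,
  the \<open>k * k\<close> diagonals of length \<open>k\<close> of a tiling of the \<open>(x, y)\<close>-square, put at distinct heights
  \<open>z\<close> that grow to the right and upwards, form a slice-increasing set of \<open>n * k\<close> points that avoids
  \<open>(+,+,-)\<close>. The witness is therefore a slightly
  tilted copy of \<open>S\<close>, in which every nonzero difference keeps its sign, while every tie is broken
  against the other two coordinates, so that \<open>(+,+,0)\<close> turns into \<open>(+,+,-)\<close> (lemmas
  \<open>tilt_less\<close> and \<open>tilt_tie\<close>).

  Let \<open>T \<subseteq> S\<close> have a tilted copy that avoids a strict type. If the type has its minus sign in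
  position \<open>k\<close>, then no two points of \<open>T\<close> agree in the coordinate \<open>k\<close>, and \<open>T\<close> has at most \<open>n\<close>
  points. If the type is \<open>(+,+,+)\<close>, then \<open>T\<close> itself avoids it. Suppose that a point \<open>p\<close> of \<open>T\<close> is
  neither the top of its slice of constant \<open>x\<close> nor the bottom of its slice of constant \<open>y\<close>. Then
  \<open>T\<close> contains \<open>p + (0,+,+)\<close> and \<open>p - (+,0,+)\<close>, whose difference has type \<open>(+,+,+)\<close>. Hence each
  point is the top of one of \<open>n\<close> slices or the bottom of one of \<open>n\<close> slices, and \<open>T\<close> has at most
  \<open>2 n\<close> points.

  For the second claim the constant factor is removed by taking powers. Writing points in base \<open>n\<close> makes
  the \<open>k\<close>-fold power of \<open>S\<close> a slice-increasing subset of the grid of side \<open>n ^ k\<close>, because the sign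
  of a difference is decided by the most significant digit that differs. The bound on \<open>m2\<close> for
  that set gives \<open>(card S powr \<alpha>) ^ k \<le> 2 * n ^ k\<close> for all \<open>k\<close>, which forces \<open>card S powr \<alpha> \<le> n\<close>.\<close>

section \<open>Slice-increasing sets in a grid\<close>

lemma finite_grid3: "finite (grid3 n)"
proof -
  have "p \<in> vec_lambda ` (\<Pi>\<^sub>E i\<in>UNIV. real ` {1..n})" if "p \<in> grid3 n" for p
    using that by (intro image_eqI[of _ _ "vec_nth p"]) (auto simp: grid3_def)
  then have "grid3 n \<subseteq> vec_lambda ` (\<Pi>\<^sub>E i\<in>UNIV. real ` {1..n})" by blast
  then show ?thesis
    by (rule finite_subset) (intro finite_imageI finite_PiE, auto)
qed

lemma grid3_bounds:
  assumes "p \<in> grid3 n"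
  shows "1 \<le> p $ i" "p $ i \<le> real n"
proof -
  have "p $ i \<in> real ` {1..n}" using assms by (simp add: grid3_def)
  then show "1 \<le> p $ i" "p $ i \<le> real n" by auto
qed

lemma grid3_less_imp_add1_le:
  assumes "p \<in> grid3 n" "q \<in> grid3 n" "p $ i < q $ j"
  shows "p $ i + 1 \<le> q $ j"
proof -
  obtain a b where "p $ i = real a" "q $ j = real b"
    using assms by (auto simp: grid3_def) (meson imageE)
  then show ?thesis using assms(3) by simp
qed

lemma card_le_if_inj_on_coordinate:
  assumes "T \<subseteq> grid3 n" "inj_on (\<lambda>p. p $ k) T"
  shows "card T \<le> n"
proof -
  have "(\<lambda>p. p $ k) ` T \<subseteq> real ` {1..n}"
    using assms(1) by (auto simp: grid3_def)
  then have "card T \<le> card (real ` {1..n})"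
    using assms(2) by (intro card_inj_on_le) auto
  also have "\<dots> \<le> n"
    using card_image_le[of "{1..n}" real] by simp
  finally show ?thesis .
qed

text \<open>If one of three coordinates ties, the two coordinates of equal sign must be the other two. So
  each slice is a chain, strictly increasing in both of its free coordinates.\<close>

lemma slice_increasing_tie:
  assumes "slice_increasing S" "p \<in> S" "q \<in> S" "p \<noteq> q" "p $ k = q $ k"
  shows "(\<forall>i. i \<noteq> k \<longrightarrow> p $ i < q $ i) \<or> (\<forall>i. i \<noteq> k \<longrightarrow> q $ i < p $ i)"
proof -
  obtain i j where ij: "i \<noteq> j" "(q - p) $ i \<noteq> 0" "(q - p) $ j \<noteq> 0"
      "sgn ((q - p) $ i) = sgn ((q - p) $ j)"
    using assms unfolding slice_increasing_def by blast
  have "i \<noteq> k" "j \<noteq> k"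
    using ij assms(5) by auto
  then have *: "l = i \<or> l = j" if "l \<noteq> k" for l
    using that ij(1) exhaust_3[of l] exhaust_3[of i] exhaust_3[of j] exhaust_3[of k] by auto
  show ?thesis
  proof (cases "p $ i < q $ i")
    case True
    then have "p $ j < q $ j" using ij by (auto simp: sgn_if split: if_splits)
    then show ?thesis using True * by blast
  next
    case False
    then have "q $ i < p $ i" "q $ j < p $ j" using ij by (auto simp: sgn_if split: if_splits)
    then show ?thesis using * by blast
  qed
qed

lemma slice_increasing_tie_less:
  assumes "slice_increasing S" "p \<in> S" "q \<in> S" "p $ k = q $ k" "p $ i < q $ i" "j \<noteq> k"
  shows "p $ j < q $ j"
  using slice_increasing_tie[OF assms(1-3) _ assms(4)] assms(4-6)
  by (metis order_less_asym order_less_irrefl)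

lemma slice_increasing_eqI:
  assumes "slice_increasing S" "p \<in> S" "q \<in> S" "p $ k = q $ k" "p $ i = q $ i" "i \<noteq> k"
  shows "p = q"
  using slice_increasing_tie[OF assms(1-3) _ assms(4)] assms(5,6) by (metis order_less_irrefl)

text \<open>The top of a slice of constant \<open>x\<close> is measured by \<open>y\<close>, the bottom of a slice of constant
  \<open>y\<close> is measured by \<open>x\<close>; as slices are chains, \<open>z\<close> orders them in the same way.\<close>

lemma card_le_if_no_positive_difference:
  assumes S: "slice_increasing S" and T: "T \<subseteq> S" "T \<subseteq> grid3 n"
    and no: "\<And>p q. p \<in> T \<Longrightarrow> q \<in> T \<Longrightarrow> \<not> (\<forall>i. p $ i < q $ i)"
  shows "card T \<le> 2 * n"
proof -
  define A where "A = {p \<in> T. \<forall>q\<in>T. q $ 1 = p $ 1 \<longrightarrow> q $ 2 \<le> p $ 2}"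
  define B where "B = {p \<in> T. \<forall>q\<in>T. q $ 2 = p $ 2 \<longrightarrow> p $ 1 \<le> q $ 1}"
  have "T \<subseteq> A \<union> B"
  proof (rule ccontr)
    assume "\<not> T \<subseteq> A \<union> B"
    then obtain p where p: "p \<in> T" "p \<notin> A" "p \<notin> B" by blast
    obtain u where u: "u \<in> T" "u $ 1 = p $ 1" "p $ 2 < u $ 2"
      using p unfolding A_def by force
    obtain v where v: "v \<in> T" "v $ 2 = p $ 2" "v $ 1 < p $ 1"
      using p unfolding B_def by force
    have "p $ 3 < u $ 3"
      using slice_increasing_tie_less[OF S, of p u 1 2 3] p u T by auto
    moreover have "v $ 3 < p $ 3"
      using slice_increasing_tie_less[OF S, of v p 2 1 3] p v T by auto
    ultimately have "\<forall>i. v $ i < u $ i"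
      using u v by (simp add: forall_3)
    then show False using no u v by blast
  qed
  moreover have "inj_on (\<lambda>p. p $ 1) A"
  proof (rule inj_onI)
    fix p q assume pq: "p \<in> A" "q \<in> A" "p $ 1 = q $ 1"
    then have "p $ 2 = q $ 2" unfolding A_def by force
    then show "p = q" using slice_increasing_eqI[OF S, of p q 1 2] pq T by (auto simp: A_def)
  qed
  then have "card A \<le> n"
    using T by (intro card_le_if_inj_on_coordinate) (auto simp: A_def)
  moreover have "inj_on (\<lambda>p. p $ 2) B"
  proof (rule inj_onI)
    fix p q assume pq: "p \<in> B" "q \<in> B" "p $ 2 = q $ 2"
    then have "p $ 1 = q $ 1" unfolding B_def by force
    then show "p = q" using slice_increasing_eqI[OF S, of p q 2 1] pq T by (auto simp: B_def)
  qed
  then have "card B \<le> n"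
    using T by (intro card_le_if_inj_on_coordinate) (auto simp: B_def)
  moreover have "finite T"
    using T(2) finite_grid3 finite_subset by blast
  then have "finite (A \<union> B)" by (simp add: A_def B_def)
  ultimately show ?thesis
    using card_mono[of "A \<union> B" T] card_Un_le[of A B] by linarith
qed

section \<open>Breaking ties by tilting\<close>

text \<open>A small multiple of the coordinate sum is subtracted from every coordinate, and the result is
  scaled by \<open>3 n\<close>. In the grid of side \<open>n\<close> two coordinate sums differ by less than \<open>3 n\<close>, too little
  to reverse a nonzero integer difference.\<close>

definition tilt :: "nat \<Rightarrow> real ^ 3 \<Rightarrow> real ^ 3" where
  "tilt n p = (\<chi> i. 3 * real n * p $ i - (p $ 1 + p $ 2 + p $ 3))"

lemma tilt_less:
  assumes "p \<in> grid3 n" "q \<in> grid3 n" "p $ i < q $ i"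
  shows "tilt n p $ i < tilt n q $ i"
proof -
  have "3 * real n * p $ i + 3 * real n \<le> 3 * real n * q $ i"
    using mult_left_mono[OF grid3_less_imp_add1_le[OF assms], of "3 * real n"]
    by (simp add: algebra_simps)
  then show ?thesis
    using grid3_bounds[OF assms(1), of 1] grid3_bounds[OF assms(1), of 2]
      grid3_bounds[OF assms(1), of 3] grid3_bounds[OF assms(2), of 1]
      grid3_bounds[OF assms(2), of 2] grid3_bounds[OF assms(2), of 3]
    by (simp add: tilt_def)
qed

lemma tilt_tie:
  assumes "p $ k = q $ k" "\<And>i. i \<noteq> k \<Longrightarrow> p $ i < q $ i"
  shows "tilt n q $ k < tilt n p $ k"
proof -
  consider "k = 1" | "k = 2" | "k = 3" using exhaust_3 by blast
  then show ?thesis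
  proof cases
    case 1
    then show ?thesis using assms(1) assms(2)[of 2] assms(2)[of 3] by (simp add: tilt_def)
  next
    case 2
    then show ?thesis using assms(1) assms(2)[of 1] assms(2)[of 3] by (simp add: tilt_def)
  next
    case 3
    then show ?thesis using assms(1) assms(2)[of 1] assms(2)[of 2] by (simp add: tilt_def)
  qed
qed

lemma inj_on_tilt: "inj_on (tilt n) (grid3 n)"
proof (rule inj_onI, rule ccontr)
  fix p q assume pq: "p \<in> grid3 n" "q \<in> grid3 n" "tilt n p = tilt n q" "p \<noteq> q"
  then obtain i where "p $ i \<noteq> q $ i" by (auto simp: vec_eq_iff)
  then show False
    using tilt_less[of p n q i] tilt_less[of q n p i] pq by (auto simp: neq_iff)
qed

lemma strict_types_cases:
  assumes "s \<in> strict_types"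
  obtains "s = (\<chi> i. 1)" | k where "s = (\<chi> i. if i = k then -1 else 1)"
proof -
  have "s = (\<chi> i. 1) \<or> s = (\<chi> i. if i = 3 then -1 else 1) \<or>
      s = (\<chi> i. if i = 2 then -1 else 1) \<or> s = (\<chi> i. if i = 1 then -1 else 1)"
    using assms by (auto simp: strict_types_def vec_eq_iff forall_3)
  then show thesis using that by blast
qed

lemma card_le_if_tilt_avoids:
  assumes S: "slice_increasing S" "S \<subseteq> grid3 n" and T: "T \<subseteq> S"
    and s: "s \<in> strict_types" and avoid: "avoids (tilt n ` T) s"
  shows "card T \<le> 2 * n"
proof -
  have grid: "T \<subseteq> grid3 n" using S T by blast
  have no: "\<not> (\<forall>i. sgn (tilt n q $ i - tilt n p $ i) = s $ i)" if "p \<in> T" "q \<in> T" for p q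
    using avoid that by (auto simp: avoids_def)
  from s show ?thesis
  proof (cases rule: strict_types_cases)
    case 1
    have "\<not> (\<forall>i. p $ i < q $ i)" if "p \<in> T" "q \<in> T" for p q
    proof
      assume "\<forall>i. p $ i < q $ i"
      then have "tilt n p $ i < tilt n q $ i" for i
        using grid that by (intro tilt_less) auto
      then show False using no[OF that] 1 by simp
    qed
    then show ?thesis
      using card_le_if_no_positive_difference S(1) T grid by blast
  next
    case (2 k)
    have increasing: "\<not> (p $ k = q $ k \<and> (\<forall>i. i \<noteq> k \<longrightarrow> p $ i < q $ i))"
      if "p \<in> T" "q \<in> T" for p q
    proof
      assume *: "p $ k = q $ k \<and> (\<forall>i. i \<noteq> k \<longrightarrow> p $ i < q $ i)"
      then have "tilt n q $ k < tilt n p $ k" by (intro tilt_tie) auto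
      moreover have "tilt n p $ i < tilt n q $ i" if "i \<noteq> k" for i
        using * that grid \<open>p \<in> T\<close> \<open>q \<in> T\<close> by (intro tilt_less) auto
      ultimately have "sgn (tilt n q $ i - tilt n p $ i) = s $ i" for i
        using 2 by (cases "i = k") simp_all
      then show False using no[OF \<open>p \<in> T\<close> \<open>q \<in> T\<close>] by blast
    qed
    have "inj_on (\<lambda>p. p $ k) T"
    proof (rule inj_onI, rule ccontr)
      fix p q assume pq: "p \<in> T" "q \<in> T" "p $ k = q $ k" "p \<noteq> q"
      then show False
        using slice_increasing_tie[OF S(1), of p q k] increasing[of p q] increasing[of q p] T
        by auto
    qed
    then show ?thesis using card_le_if_inj_on_coordinate[OF grid] by fastforce
  qed
qed

text \<open>One witness bounds every admissible \<open>M\<close>. This also guarantees that the greatest admissible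
  \<open>M\<close> exists, since \<open>0\<close> is admissible, and hence that \<open>m2\<close> is itself admissible.\<close>

lemma m2_le:
  assumes "finite S" "card S = N"
    and bound: "\<And>T s. T \<subseteq> S \<Longrightarrow> s \<in> strict_types \<Longrightarrow> avoids T s \<Longrightarrow> card T \<le> b"
  shows "m2 N \<le> b"
proof -
  define P where "P M \<longleftrightarrow> (\<forall>S :: (real ^ 3) set. finite S \<and> card S = N \<longrightarrow>
             (\<exists>T \<subseteq> S. card T = M \<and> (\<exists>s\<in>strict_types. avoids T s)))" for M
  have "P 0"
    unfolding P_def by (auto intro!: exI[of _ "{}"] simp: avoids_def strict_types_def)
  moreover have le: "M \<le> b" if "P M" for M
    using that assms unfolding P_def by blast
  ultimately have "P (Greatest P)"
    by (rule GreatestI_nat)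
  then show ?thesis
    using le unfolding m2_def P_def by blast
qed

lemma m2_card_slice_increasing_le:
  assumes "slice_increasing S" "S \<subseteq> grid3 n"
  shows "m2 (card S) \<le> 2 * n"
proof (rule m2_le)
  have fin: "finite S" using assms(2) finite_grid3 finite_subset by blast
  then show "finite (tilt n ` S)" by simp
  show "card (tilt n ` S) = card S"
    using assms(2) inj_on_tilt by (metis card_image inj_on_subset)
  fix T s assume "T \<subseteq> tilt n ` S" and s: "s \<in> strict_types" "avoids T s"
  then obtain T' where T': "T' \<subseteq> S" "T = tilt n ` T'" by (meson subset_imageE)
  have "card T \<le> card T'"
    using T' fin card_image_le finite_subset by blast
  also have "\<dots> \<le> 2 * n"
    using card_le_if_tilt_avoids[OF assms T'(1)] s T'(2) by blast
  finally show "card T \<le> 2 * n" .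
qed

section \<open>Powers of slice-increasing sets\<close>

text \<open>Two-digit numbers in base \<open>n\<close>, coordinate by coordinate; the shift by 1 keeps the coordinates
  in a grid that starts at 1.\<close>

definition digits :: "nat \<Rightarrow> (real ^ 3) \<times> (real ^ 3) \<Rightarrow> real ^ 3" where
  "digits n = (\<lambda>(p, q). \<chi> i. real n * (p $ i - 1) + q $ i)"

lemma digits_less:
  assumes "p \<in> grid3 m" "p' \<in> grid3 m" "q \<in> grid3 n" "q' \<in> grid3 n" "p $ i < p' $ i"
  shows "digits n (p, q) $ i < digits n (p', q') $ i"
proof -
  have "real n * p $ i + real n \<le> real n * p' $ i"
    using mult_left_mono[OF grid3_less_imp_add1_le[OF assms(1,2,5)], of "real n"]
    by (simp add: algebra_simps)
  then show ?thesis
    using grid3_bounds[OF assms(3), of i] grid3_bounds[OF assms(4), of i]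
    by (simp add: digits_def algebra_simps)
qed

lemma sgn_digits_diff:
  assumes "p \<in> grid3 m" "p' \<in> grid3 m" "q \<in> grid3 n" "q' \<in> grid3 n" "(p' - p) $ i \<noteq> 0"
  shows "sgn ((digits n (p', q') - digits n (p, q)) $ i) = sgn ((p' - p) $ i)"
  using digits_less[OF assms(1,2,3,4), of i] digits_less[OF assms(2,1,4,3), of i] assms(5)
  by (cases "p $ i" "p' $ i" rule: linorder_cases) (auto simp: sgn_if)

lemma digits_in_grid3:
  assumes "p \<in> grid3 m" "q \<in> grid3 n"
  shows "digits n (p, q) \<in> grid3 (m * n)"
proof -
  have "digits n (p, q) $ i \<in> real ` {1..m * n}" for i
  proof -
    obtain a b where ab: "p $ i = real a" "q $ i = real b" "1 \<le> a" "a \<le> m" "1 \<le> b" "b \<le> n"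
      using assms unfolding grid3_def by (smt (verit) atLeastAtMost_iff imageE mem_Collect_eq)
    have "n * (a - 1) + b \<le> n * (a - 1) + n * 1" using ab by simp
    also have "\<dots> = n * a" using ab by (cases a) auto
    also have "\<dots> \<le> m * n" using ab by simp
    finally have "n * (a - 1) + b \<in> {1..m * n}" using ab by simp
    moreover have "digits n (p, q) $ i = real (n * (a - 1) + b)"
      using ab by (simp add: digits_def)
    ultimately show ?thesis by blast
  qed
  then show ?thesis by (simp add: grid3_def)
qed

text \<open>Where the leading points differ, two of their coordinates differ with the same sign, and these
  leading digits decide; where they agree, the trailing points decide.\<close>

lemma digits_two_equal_signs:
  assumes S: "slice_increasing S" "S \<subseteq> grid3 m" and R: "slice_increasing R" "R \<subseteq> grid3 n"
    and x: "x \<in> S \<times> R" and y: "y \<in> S \<times> R" and "x \<noteq> y"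
  shows "\<exists>i j. i \<noteq> j \<and> (digits n y - digits n x) $ i \<noteq> 0 \<and> (digits n y - digits n x) $ j \<noteq> 0 \<and>
    sgn ((digits n y - digits n x) $ i) = sgn ((digits n y - digits n x) $ j)"
proof -
  obtain p q p' q' where xy: "x = (p, q)" "y = (p', q')" "p \<in> S" "p' \<in> S" "q \<in> R" "q' \<in> R"
    using x y by blast
  show ?thesis
  proof (cases "p = p'")
    case True
    then have "q \<noteq> q'" using xy \<open>x \<noteq> y\<close> by simp
    moreover have "digits n y - digits n x = q' - q"
      by (simp add: xy True digits_def vec_eq_iff)
    ultimately show ?thesis
      using R(1) xy(5,6) unfolding slice_increasing_def by metis
  next
    case False
    then obtain i j where ij: "i \<noteq> j" "(p' - p) $ i \<noteq> 0" "(p' - p) $ j \<noteq> 0"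
        "sgn ((p' - p) $ i) = sgn ((p' - p) $ j)"
      using S(1) xy(3,4) unfolding slice_increasing_def by metis
    have sgn: "sgn ((digits n y - digits n x) $ l) = sgn ((p' - p) $ l)" if "(p' - p) $ l \<noteq> 0" for l
      unfolding xy using S(2) R(2) xy(3-6) that by (intro sgn_digits_diff[where m = m]) auto
    then have "(digits n y - digits n x) $ i \<noteq> 0" "(digits n y - digits n x) $ j \<noteq> 0"
      using ij by (metis sgn_0_0)+
    then show ?thesis using ij sgn by metis
  qed
qed

lemma slice_increasing_product:
  assumes "slice_increasing S" "S \<subseteq> grid3 m" "slice_increasing R" "R \<subseteq> grid3 n"
  obtains Q where "slice_increasing Q" "Q \<subseteq> grid3 (m * n)" "card Q = card S * card R"
proof
  note signs = digits_two_equal_signs[OF assms]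
  show "slice_increasing (digits n ` (S \<times> R))"
    unfolding slice_increasing_def
  proof (intro ballI impI)
    fix u v assume "u \<in> digits n ` (S \<times> R)" "v \<in> digits n ` (S \<times> R)" "u \<noteq> v"
    then obtain x y where xy: "x \<in> S \<times> R" "y \<in> S \<times> R" "x \<noteq> y"
        "u = digits n x" "v = digits n y"
      by blast
    show "\<exists>i j. i \<noteq> j \<and> (v - u) $ i \<noteq> 0 \<and> (v - u) $ j \<noteq> 0 \<and>
        sgn ((v - u) $ i) = sgn ((v - u) $ j)"
      unfolding xy(4,5) using xy(1-3) by (rule signs)
  qed
  show "digits n ` (S \<times> R) \<subseteq> grid3 (m * n)"
    using assms(2,4) digits_in_grid3 by blast
  have "inj_on (digits n) (S \<times> R)"
  proof (rule inj_onI, rule ccontr)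
    fix x y assume "x \<in> S \<times> R" "y \<in> S \<times> R" "digits n x = digits n y" "x \<noteq> y"
    then show False using signs[of x y] by auto
  qed
  then show "card (digits n ` (S \<times> R)) = card S * card R"
    by (simp add: card_image card_cartesian_product)
qed

lemma slice_increasing_power:
  assumes "slice_increasing S" "S \<subseteq> grid3 n"
  shows "\<exists>Q. slice_increasing Q \<and> Q \<subseteq> grid3 (n ^ k) \<and> card Q = card S ^ k"
proof (induction k)
  case 0
  have "slice_increasing {\<chi> i. 1}" "{\<chi> i. 1} \<subseteq> grid3 (n ^ 0)"
      "card {(\<chi> i. 1) :: real ^ 3} = card S ^ 0"
    by (auto simp: slice_increasing_def grid3_def)
  then show ?case by blast
next
  case (Suc k)
  then obtain Q where "slice_increasing Q" "Q \<subseteq> grid3 (n ^ k)" "card Q = card S ^ k" by blast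
  then show ?case
    using slice_increasing_product[OF assms, of Q "n ^ k"] by (metis power_Suc)
qed

section \<open>The bound on slice-increasing sets\<close>

lemma le_1_if_powers_bounded:
  fixes x b :: real
  assumes "\<And>k. x ^ k \<le> b"
  shows "x \<le> 1"
  using real_arch_pow[of x b] assms by (meson not_less)

theorem theorem4p8:
  fixes n :: nat and S :: "(real ^ 3) set"
  assumes "n \<ge> 1"
    and "S \<subseteq> grid3 n"
    and "slice_increasing S"
  shows "m2 (card S) \<le> 3 * n \<and>
    (\<forall>\<alpha>::real. \<alpha> > 1 / 2 \<and> (\<forall>N::nat. real (m2 N) \<ge> real N powr \<alpha>) \<longrightarrow>
       real (card S) \<le> real n powr (1 / \<alpha>))"
proof (intro conjI allI impI)
  show "m2 (card S) \<le> 3 * n"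
    using m2_card_slice_increasing_le[OF assms(3,2)] by simp
next
  fix \<alpha> :: real
  assume "\<alpha> > 1 / 2 \<and> (\<forall>N::nat. real (m2 N) \<ge> real N powr \<alpha>)"
  then have \<alpha>: "\<alpha> > 0" and lower: "\<And>N. real N powr \<alpha> \<le> real (m2 N)" by auto
  have "(real (card S) powr \<alpha> / real n) ^ k \<le> 2" for k
  proof -
    obtain Q where Q: "slice_increasing Q" "Q \<subseteq> grid3 (n ^ k)" "card Q = card S ^ k"
      using slice_increasing_power[OF assms(3,2)] by blast
    have "(real (card S) powr \<alpha>) ^ k = real (card Q) powr \<alpha>"
      unfolding Q(3) by (induction k) (auto simp: powr_mult)
    also have "\<dots> \<le> real (m2 (card Q))" by (rule lower)
    also have "\<dots> \<le> real (2 * n ^ k)"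
      using m2_card_slice_increasing_le[OF Q(1,2)] by (simp only: of_nat_le_iff)
    finally show ?thesis
      using assms(1) by (simp add: power_divide field_simps)
  qed
  then have "real (card S) powr \<alpha> / real n \<le> 1" by (rule le_1_if_powers_bounded)
  then have "real (card S) powr \<alpha> \<le> real n"
    using assms(1) by (simp add: field_simps)
  then have "(real (card S) powr \<alpha>) powr (1 / \<alpha>) \<le> real n powr (1 / \<alpha>)"
    using \<alpha> by (intro powr_mono2) auto
  then show "real (card S) \<le> real n powr (1 / \<alpha>)"
    using \<alpha> by (simp add: powr_powr)
qed

end
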